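(* Let $n$ be a positive integer and let \[ W = (n\mathbb{N} + A) \cup F \cup G, \] where $A$ is a nonempty finite set of integers, $F$ is a finite set of integers with $(F \bmod n) \subseteq (A \bmod n)$, and $G$ is a (possibly infinite) set of integers with $(G \bmod n) \cap (A \bmod n) = \emptyset$ such that all elements of $G$ lie in a single residue class modulo $n$. Write $W \bmod n$, $A \bmod n$, etc. for the sets of residues in $\mathbb{Z}/n\mathbb{Z}$ of the elements of these sets. Suppose there exists $S \subseteq \mathbb{Z}/n\mathbb{Z}$ such that (i) $S + (W \bmod n) = \mathbb{Z}/n\mathbb{Z}$, and (ii) for every $s \in S$ there exists $g \in G$ such that $s + (g \bmod n) \notin (S \setminus \{s\}) + (W \bmod n)$. If $G$ has a minimal additive complement, then $W$ has a minimal additive complement.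
   Context: $\mathbb{N}$ denotes the set of nonnegative integers, and $n\mathbb{N} + A = \{nk + a : k \in \mathbb{N}, a \in A\}$. For $X, Y \subseteq \mathbb{Z}$, $X + Y = \{x + y : x \in X, y \in Y\}$. A set $C \subseteq \mathbb{Z}$ is an additive complement to $W \subseteq \mathbb{Z}$ if $C + W = \mathbb{Z}$; it is a minimal additive complement to $W$ if moreover no proper subset of $C$ is an additive complement to $W$. *)

theory Defs
  imports Main
begin

definition sumset :: "int set \<Rightarrow> int set \<Rightarrow> int set" where
  "sumset X Y = {x + y | x y. x \<in> X \<and> y \<in> Y}"

definition add_complement :: "int set \<Rightarrow> int set \<Rightarrow> bool" where
  "add_complement C W \<longleftrightarrow> sumset C W = UNIV"

definition min_add_complement :: "int set \<Rightarrow> int set \<Rightarrow> bool" where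
  "min_add_complement C W \<longleftrightarrow> add_complement C W \<and> (\<forall>C'. C' \<subset> C \<longrightarrow> \<not> add_complement C' W)"

definition has_min_complement :: "int set \<Rightarrow> bool" where
  "has_min_complement W \<longleftrightarrow> (\<exists>C. min_add_complement C W)"

definition nN_plus :: "int \<Rightarrow> int set \<Rightarrow> int set" where
  "nN_plus n A = {n * int k + a | k a. a \<in> A}"

text \<open>Residues mod n, represented by the canonical representatives in {0..<n}.\<close>
definition modset :: "int \<Rightarrow> int set \<Rightarrow> int set" where
  "modset n X = (\<lambda>x. x mod n) ` X"

definition sumset_mod :: "int \<Rightarrow> int set \<Rightarrow> int set \<Rightarrow> int set" where
  "sumset_mod n X Y = {(x + y) mod n | x y. x \<in> X \<and> y \<in> Y}"

end

theory Submission
  imports Defs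
begin

text \<open>
  The condition on \<open>S\<close> only matters when \<open>G\<close> is bounded below. In that case every residue class
  of a minimal complement \<open>C\<close> of \<open>G\<close> is unbounded below, so the elements of \<open>C\<close> with residue
  in \<open>S\<close> cover the classes \<open>s + a\<close> by means of \<open>n\<nat> + A\<close>, while the class \<open>s + g\<close> can only be
  covered through \<open>G\<close>, which forces minimality.

  If \<open>G\<close> is unbounded below, then so is \<open>W\<close>, and finitely many translates of \<open>W\<close> cover a right
  half-line. If the gaps of \<open>W\<close> are bounded, \<open>W\<close> has a finite complement. Otherwise
  the remaining integers are covered greedily in decreasing order: an uncovered \<open>x\<close> is covered by
  a translate of \<open>W\<close> that has a long gap just above \<open>x\<close>, and hence misses all the integers for
  which earlier translates were chosen.
\<close>

lemma add_complement_iff: "add_complement C W \<longleftrightarrow> (\<forall>x. \<exists>c\<in>C. x - c \<in> W)"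
proof -
  have "x = c + w \<longleftrightarrow> w = x - c" for x c w :: int by auto
  then have "x \<in> sumset C W \<longleftrightarrow> (\<exists>c\<in>C. x - c \<in> W)" for x
    unfolding sumset_def by auto
  then show ?thesis
    unfolding add_complement_def by blast
qed

lemma add_complement_mono: "add_complement C W \<Longrightarrow> C \<subseteq> D \<Longrightarrow> add_complement D W"
  unfolding add_complement_iff by blast

text \<open>Shrink \<open>B\<close> to a subset \<open>X\<close> of least size for which
  \<open>X \<union> D\<close> is still a complement. No element of \<open>X\<close> can then go, and
  no element of \<open>D\<close> can go even when all of \<open>B\<close> is present.\<close>

lemma min_complement_of_finite_extension:
  assumes fin: "finite B"
    and compl: "add_complement (B \<union> D) W"
    and needed: "\<And>d. d \<in> D \<Longrightarrow> \<not> add_complement (B \<union> D - {d}) W"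
  shows "has_min_complement W"
proof -
  let ?P = "\<lambda>X. X \<subseteq> B \<and> add_complement (X \<union> D) W"
  obtain X where X: "?P X" and least: "\<And>Y. ?P Y \<Longrightarrow> card X \<le> card Y"
    using ex_has_least_nat[of ?P B card] compl by blast
  have "\<not> add_complement C' W" if C': "C' \<subset> X \<union> D" for C'
  proof
    assume compl': "add_complement C' W"
    obtain e where e: "e \<in> X \<union> D" "e \<notin> C'" using C' by blast
    show False
    proof (cases "e \<in> D")
      case True
      moreover have "C' \<subseteq> B \<union> D - {e}" using C' e X by blast
      ultimately show False using needed add_complement_mono compl' by blast
    next
      case False
      then have "e \<in> X" using e by blast
      have "C' \<subseteq> (X - {e}) \<union> D" using C' e by blast
      then have "?P (X - {e})" using X add_complement_mono compl' by blast
      moreover have "card (X - {e}) < card X"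
        using \<open>e \<in> X\<close> X fin by (meson card_Diff1_less finite_subset)
      ultimately show False using least[of "X - {e}"] by linarith
    qed
  qed
  then show ?thesis
    using X unfolding has_min_complement_def min_add_complement_def by blast
qed

lemma finite_complement_imp_min_complement:
  assumes "finite B" "add_complement B W"
  shows "has_min_complement W"
  using min_complement_of_finite_extension[of B "{}"] assms by simp

text \<open>Membership of \<open>k\<close> depends only on smaller members, so well-founded
  recursion yields \<open>K\<close>. In the application, \<open>R j k\<close> says that the
  translate chosen for \<open>j\<close> already covers the \<open>k\<close>-th point.\<close>

lemma greedy_subset_exists:
  fixes P :: "nat \<Rightarrow> bool" and R :: "nat \<Rightarrow> nat \<Rightarrow> bool"
  shows "\<exists>K. \<forall>k. k \<in> K \<longleftrightarrow> P k \<and> (\<forall>j\<in>K. j < k \<longrightarrow> \<not> R j k)"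
proof -
  define Q where "Q = wfrec less_than (\<lambda>g k. P k \<and> (\<forall>j<k. g j \<longrightarrow> \<not> R j k))"
  have "Q k \<longleftrightarrow> P k \<and> (\<forall>j<k. Q j \<longrightarrow> \<not> R j k)" for k
    unfolding Q_def by (subst wfrec[OF wf_less_than]) (auto simp: cut_def)
  then show ?thesis by (intro exI[of _ "{k. Q k}"]) blast
qed

lemma min_complement_of_unbounded_below:
  fixes W :: "int set"
  assumes unbdd: "\<And>m. \<exists>w\<in>W. w < m"
    and fin: "finite B"
    and half_line: "\<And>x. M \<le> x \<Longrightarrow> \<exists>b\<in>B. x - b \<in> W"
  shows "has_min_complement W"
proof (cases "\<forall>k::nat. \<exists>a\<in>W. \<forall>w\<in>W. \<not> (a < w \<and> w \<le> a + int k)")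
  case True
  then obtain a where a: "\<And>k. a k \<in> W"
    and gap: "\<And>k w. w \<in> W \<Longrightarrow> \<not> (a k < w \<and> w \<le> a k + int k)"
    by metis
  \<comment> \<open>The integers below \<open>M\<close> in decreasing order; the shift
    \<open>c k\<close> moves \<open>a k\<close>, which precedes a gap of length at least
    \<open>k\<close>, onto \<open>x k\<close>.\<close>
  define x where "x k = M - 1 - int k" for k
  define c where "c k = x k - a k" for k
  have covers: "x k - c k \<in> W" for k
    using a by (simp add: c_def)
  \<comment> \<open>Here \<open>x j - c k\<close> equals \<open>a k + (k - j)\<close>, a point of
    the gap after \<open>a k\<close>.\<close>
  have misses: "x j - c k \<notin> W" if "j < k" for j k
    using gap[of "x j - c k" k] that by (auto simp: c_def x_def)
  obtain K where K: "\<And>k. k \<in> K \<longleftrightarrow>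
      (\<forall>b\<in>B. x k - b \<notin> W) \<and> (\<forall>j\<in>K. j < k \<longrightarrow> \<not> x k - c j \<in> W)"
    using greedy_subset_exists[of "\<lambda>k. \<forall>b\<in>B. x k - b \<notin> W" "\<lambda>j k. x k - c j \<in> W"] by blast
  show ?thesis
  proof (rule min_complement_of_finite_extension[OF fin, of "c ` K"])
    show "add_complement (B \<union> c ` K) W"
      unfolding add_complement_iff
    proof
      fix y
      show "\<exists>d\<in>B \<union> c ` K. y - d \<in> W"
      proof (cases "M \<le> y")
        case True
        then show ?thesis using half_line by blast
      next
        case False
        then have "y = x (nat (M - 1 - y))" by (simp add: x_def)
        then obtain k where y: "y = x k" by blast
        show ?thesis
          using K[of k] covers[of k] unfolding y by blast
      qed
    qed
  next
    fix d assume "d \<in> c ` K"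
    then obtain k where k: "k \<in> K" "d = c k" by blast
    \<comment> \<open>The point \<open>x k\<close> shows that \<open>c k\<close> is needed:
      \<open>B\<close> and earlier translates miss it by the choice of \<open>K\<close>, later ones
      by their gaps.\<close>
    have "x k - e \<notin> W" if e: "e \<in> B \<union> c ` K - {d}" for e
    proof (cases "e \<in> B")
      case True
      then show ?thesis using K k by blast
    next
      case False
      then obtain j where j: "j \<in> K" "e = c j" "j \<noteq> k" using e k by blast
      then consider "j < k" | "k < j" by linarith
      then show ?thesis using K k j misses by cases blast+
    qed
    then show "\<not> add_complement (B \<union> c ` K - {d}) W"
      unfolding add_complement_iff by blast
  qed
next
  case False
  then obtain k :: nat where
    next_le: "\<And>a. a \<in> W \<Longrightarrow> \<exists>w\<in>W. a < w \<and> w \<le> a + int k" by blast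
  have "add_complement {0..int k} W"
    unfolding add_complement_iff
  proof
    fix x
    \<comment> \<open>Take \<open>w\<close> to be the largest element of \<open>W\<close> up to
      \<open>x\<close>; its successor in \<open>W\<close> is at most \<open>w + k\<close>, which
      bounds \<open>x - w\<close>.\<close>
    obtain w0 where "w0 \<in> W" "w0 < x" using unbdd by blast
    then obtain w where w: "w \<in> W" "w \<le> x"
      and nearest: "\<And>v. v \<in> W \<Longrightarrow> v \<le> x \<Longrightarrow> nat (x - w) \<le> nat (x - v)"
      using ex_has_least_nat[of "\<lambda>w. w \<in> W \<and> w \<le> x" w0 "\<lambda>w. nat (x - w)"] by auto
    obtain v where v: "v \<in> W" "w < v" "v \<le> w + int k" using next_le w by blast
    have "x < v" using nearest[of v] v w by linarith
    then show "\<exists>c\<in>{0..int k}. x - c \<in> W"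
      using v w by (intro bexI[of _ "x - w"]) auto
  qed
  then show ?thesis by (intro finite_complement_imp_min_complement) auto
qed

theorem theorem6:
  fixes n :: int and A F G W :: "int set"
  assumes "n > 0"
    and "A \<noteq> {}" and "finite A"
    and "finite F" and "modset n F \<subseteq> modset n A"
    and "modset n G \<inter> modset n A = {}"
    and "\<exists>r. \<forall>g\<in>G. g mod n = r"
    and "W = nN_plus n A \<union> F \<union> G"
    and "\<exists>S. S \<subseteq> {0..<n}
           \<and> sumset_mod n S (modset n W) = {0..<n}
           \<and> (\<forall>s\<in>S. \<exists>g\<in>G. (s + g) mod n \<notin> sumset_mod n (S - {s}) (modset n W))"
    and "has_min_complement G"
  shows "has_min_complement W"
proof (cases "\<forall>m. \<exists>g\<in>G. g < m")
  case True
  obtain a where a: "a \<in> A" using assms(2) by blast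
  show ?thesis
  proof (rule min_complement_of_unbounded_below)
    show "\<exists>w\<in>W. w < m" for m using True assms(8) by blast
    show "finite {0..<n}" by simp
    fix x assume x: "a \<le> x"
    have "x - (x - a) mod n = n * int (nat ((x - a) div n)) + a"
      using x \<open>n > 0\<close> by (simp add: pos_imp_zdiv_nonneg_iff minus_mod_eq_mult_div[symmetric])
    then have "x - (x - a) mod n \<in> W"
      using a unfolding assms(8) nN_plus_def by blast
    then show "\<exists>b\<in>{0..<n}. x - b \<in> W"
      using \<open>n > 0\<close> by (intro bexI[of _ "(x - a) mod n"]) auto
  qed
next
  case False
  then obtain m where m: "\<And>g. g \<in> G \<Longrightarrow> m \<le> g" by (meson not_le)
  obtain r where r: "\<And>g. g \<in> G \<Longrightarrow> g mod n = r" using assms(7) by blast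
  obtain C where C: "add_complement C G"
    and C_min: "\<And>C'. C' \<subset> C \<Longrightarrow> \<not> add_complement C' G"
    using assms(10) unfolding has_min_complement_def min_add_complement_def by blast
  obtain S where S: "S \<subseteq> {0..<n}" "sumset_mod n S (modset n W) = {0..<n}"
    and S_priv: "\<And>s. s \<in> S \<Longrightarrow>
      \<exists>g\<in>G. (s + g) mod n \<notin> sumset_mod n (S - {s}) (modset n W)"
    using assms(9) by blast
  obtain g0 where g0: "g0 \<in> G"
    using C unfolding add_complement_iff by blast
  have W_cases: "w \<in> G \<or> (\<exists>a\<in>A. w mod n = a mod n)" if "w \<in> W" for w
    using that assms(5) unfolding assms(8) nN_plus_def modset_def by fastforce
  \<comment> \<open>This part of \<open>C\<close> will itself be the minimal complement of
    \<open>W\<close>.\<close>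
  define T where "T = {c \<in> C. c mod n \<in> S}"
  have "add_complement T W"
    unfolding add_complement_iff
  proof
    fix x
    have "x mod n \<in> sumset_mod n S (modset n W)" using S \<open>n > 0\<close> by simp
    then obtain s w where s: "s \<in> S" and w: "w \<in> W" and xsw: "x mod n = (s + w) mod n"
      unfolding sumset_mod_def modset_def by (auto simp: mod_simps)
    have s_mod: "s mod n = s" using s S by auto
    show "\<exists>c\<in>T. x - c \<in> W"
    proof (cases "w \<in> G")
      case True
      obtain c where c: "c \<in> C" "x - c \<in> G" using C unfolding add_complement_iff by blast
      have "(x - c) mod n = w mod n" using r c True by simp
      then have "c mod n = s mod n"
        using xsw unfolding mod_eq_dvd_iff by (smt (verit) dvd_diff)
      then show ?thesis using c s s_mod unfolding T_def assms(8) by auto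
    next
      case False
      then obtain a where a: "a \<in> A" "w mod n = a mod n" using W_cases w by blast
      \<comment> \<open>The point \<open>s + g0 - n * k\<close> is so low that, \<open>G\<close>
        being bounded below by \<open>m\<close>, any \<open>c\<close> covering it through
        \<open>G\<close> is at most \<open>x - a\<close>. Since \<open>G\<close> lies in one class,
        \<open>c\<close> is congruent to \<open>s\<close>.\<close>
      define k where "k = \<bar>s + g0 - m - x + a\<bar>"
      obtain c where c: "c \<in> C" "s + g0 - n * k - c \<in> G"
        using C unfolding add_complement_iff by blast
      have "(s + g0 - n * k - c) mod n = g0 mod n" using r c g0 by simp
      then have "n dvd s - n * k - c" unfolding mod_eq_dvd_iff by (simp add: algebra_simps)
      then have "n dvd s - n * k - c + n * k" by (intro dvd_add) auto
      then have s_c: "n dvd s - c" by simp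
      then have "c mod n = s" using s_mod by (metis mod_eq_dvd_iff)
      then have "c \<in> T" using c s unfolding T_def by blast
      have "n dvd x - a - c"
        using xsw a s_c unfolding mod_eq_dvd_iff by (smt (verit) dvd_add)
      then obtain q where q: "x - a - c = n * q" by blast
      have "k \<le> n * k" using \<open>n > 0\<close> mult_right_mono[of 1 n k] by (simp add: k_def)
      then have "0 \<le> n * q" using m[OF c(2)] q unfolding k_def by linarith
      then have "0 \<le> q" using \<open>n > 0\<close> by (simp add: zero_le_mult_iff)
      then have "x - c = n * int (nat q) + a" using q by simp
      then have "x - c \<in> W" using a unfolding assms(8) nN_plus_def by blast
      then show ?thesis using \<open>c \<in> T\<close> by blast
    qed
  qed
  moreover have "\<not> add_complement C' W" if C': "C' \<subset> T" for C'
  proof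
    assume compl: "add_complement C' W"
    obtain e where e: "e \<in> T" "e \<notin> C'" using C' by blast
    then have "C - {e} \<subset> C" unfolding T_def by blast
    then have "\<not> add_complement (C - {e}) G" by (rule C_min)
    \<comment> \<open>Within \<open>C\<close>, only \<open>e\<close> covers \<open>y\<close> through
      \<open>G\<close>.\<close>
    then obtain y where y: "\<And>c. c \<in> C - {e} \<Longrightarrow> y - c \<notin> G"
      unfolding add_complement_iff by blast
    obtain c0 where "c0 \<in> C" "y - c0 \<in> G" using C unfolding add_complement_iff by blast
    then have y_e: "y - e \<in> G" using y by blast
    obtain c where c: "c \<in> C'" "y - c \<in> W" using compl unfolding add_complement_iff by blast
    then have "c \<in> T" "c \<noteq> e" using C' e by auto
    then have "y - c \<notin> G" using y unfolding T_def by blast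
    then obtain a where a: "a \<in> A" "(y - c) mod n = a mod n" using W_cases c by blast
    show False
    proof (cases "c mod n = e mod n")
      case True
      then have "(y - e) mod n = (y - c) mod n" by (metis mod_diff_right_eq)
      then show False using y_e a assms(6) unfolding modset_def by force
    next
      case False
      \<comment> \<open>Both \<open>g\<close> and \<open>y - e\<close> lie in the class of
        \<open>G\<close>, so \<open>y\<close> is congruent to \<open>e + g\<close>, which no other
        class of \<open>S\<close> may reach.\<close>
      obtain g where g: "g \<in> G"
        "(e mod n + g) mod n \<notin> sumset_mod n (S - {e mod n}) (modset n W)"
        using S_priv e unfolding T_def by blast
      have "g mod n = (y - e) mod n" using r g y_e by simp
      then have "(e mod n + g) mod n = (e + (y - e)) mod n" by (metis mod_add_cong mod_mod_trivial)
      also have "\<dots> = (c mod n + (y - c) mod n) mod n" by (simp add: mod_simps)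
      finally have "(e mod n + g) mod n \<in> sumset_mod n (S - {e mod n}) (modset n W)"
        using \<open>c \<in> T\<close> False c unfolding sumset_mod_def modset_def T_def by blast
      then show False using g by blast
    qed
  qed
  ultimately show ?thesis
    unfolding has_min_complement_def min_add_complement_def by blast
qed

end
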